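(* Let $\mathcal{M} = \mathcal{SO}(3)\times\mathbb{R}^3\times\mathcal{SO}(3)$ with elements $\xi=((\mathbf{R},\boldsymbol{b}),\mathbf{C})$, and let $\mathbf{G} = (\mathbf{SO}(3)\ltimes\mathfrak{so}(3))\times\mathbf{SO}(3)$ with elements $X=((A,a),B)$. Define $\phi:\mathbf{G}\times\mathcal{M}\to\mathcal{M}$ by $$\phi(X,\xi) := \big(\mathbf{R}A,\; A^{\top}(\boldsymbol{b}-a^{\vee}),\; A^{\top}\mathbf{C}B\big).$$ Then $\phi$ is a transitive right group action of $\mathbf{G}$ on $\mathcal{M}$.
   Context: $\mathcal{SO}(3)$ denotes the underlying smooth manifold of the Lie group $\mathbf{SO}(3)$ (rotation matrices without the group structure). For $\boldsymbol{v}\in\mathbb{R}^3$, $\boldsymbol{v}^{\wedge}\in\mathfrak{so}(3)$ is the skew-symmetric matrix with $\boldsymbol{v}^{\wedge}\boldsymbol{w}=\boldsymbol{v}\times\boldsymbol{w}$, and $(\cdot)^{\vee}:\mathfrak{so}(3)\to\mathbb{R}^3$ is the inverse map. The group product in $\mathbf{G}$ is: for $X=((A_X,a_X),B_X)$ and $Y=((A_Y,a_Y),B_Y)$ with $A_X,A_Y,B_X,B_Y\in\mathbf{SO}(3)$, $a_X,a_Y\in\mathfrak{so}(3)$, $$XY=\big((A_XA_Y,\;a_X+A_Xa_YA_X^{\top}),\;B_XB_Y\big),$$ with inverse $X^{-1}=((A^{\top},-A^{\top}aA),B^{\top})$. A right group action is a smooth map $\phi:\mathbf{G}\times\mathcal{M}\to\mathcal{M}$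 with $\phi(I,\xi)=\xi$ and $\phi(X,\phi(Y,\xi))=\phi(YX,\xi)$. It is transitive if for all $\xi_1,\xi_2\in\mathcal{M}$ there is $Z\in\mathbf{G}$ with $\phi(Z,\xi_1)=\xi_2$. *)

theory Defs
  imports "HOL-Analysis.Analysis" "HOL-Algebra.Group"
begin

unbundle no cross3_syntax
unbundle set_product_syntax

primrec higher_differentiable_on ::
  "nat \<Rightarrow> 'a::real_normed_vector set \<Rightarrow> ('a \<Rightarrow> 'b::real_normed_vector) \<Rightarrow> bool" where
  "higher_differentiable_on 0 U f \<longleftrightarrow> continuous_on U f"
| "higher_differentiable_on (Suc n) U f \<longleftrightarrow>
     (\<forall>x\<in>U. f differentiable (at x)) \<and>
     (\<forall>v. higher_differentiable_on n U (\<lambda>x. frechet_derivative f (at x) v))"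

text \<open>Meant for open \<open>U\<close>: all iterated directional derivatives exist and are continuous,
  which in finite dimension is the class \<open>C\<^sup>\<infinity>\<close>.\<close>

definition smooth_on :: "'a::euclidean_space set \<Rightarrow> ('a \<Rightarrow> 'b::euclidean_space) \<Rightarrow> bool" where
  "smooth_on U f \<longleftrightarrow> (\<forall>n. higher_differentiable_on n U f)"

text \<open>Smoothness of a map from \<open>S\<close> to \<open>T\<close>: locally around each point of \<open>S\<close> the map is the
  restriction of a smooth map on an open set of the ambient space.  For embedded submanifolds \<open>S\<close>
  and \<open>T\<close> this is smoothness with respect to their submanifold structures.\<close>

definition smooth_map ::
  "'a::euclidean_space set \<Rightarrow> 'b::euclidean_space set \<Rightarrow> ('a \<Rightarrow> 'b) \<Rightarrow> bool" where
  "smooth_map S T f \<longleftrightarrow> f ` S \<subseteq> T \<and>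
     (\<forall>x\<in>S. \<exists>U g. open U \<and> x \<in> U \<and> smooth_on U g \<and> (\<forall>y\<in>U \<inter> S. g y = f y))"

definition right_group_action ::
  "('g::euclidean_space, 'r) monoid_scheme \<Rightarrow> 'm::euclidean_space set \<Rightarrow> ('g \<Rightarrow> 'm \<Rightarrow> 'm) \<Rightarrow> bool"
where
  "right_group_action G M \<phi> \<longleftrightarrow> group G \<and>
     smooth_map (carrier G \<times> M) M (\<lambda>(X, \<xi>). \<phi> X \<xi>) \<and>
     (\<forall>\<xi>\<in>M. \<phi> \<one>\<^bsub>G\<^esub> \<xi> = \<xi>) \<and>
     (\<forall>X\<in>carrier G. \<forall>Y\<in>carrier G. \<forall>\<xi>\<in>M. \<phi> X (\<phi> Y \<xi>) = \<phi> (Y \<otimes>\<^bsub>G\<^esub> X) \<xi>)"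

definition transitive_action ::
  "('g, 'r) monoid_scheme \<Rightarrow> 'm set \<Rightarrow> ('g \<Rightarrow> 'm \<Rightarrow> 'm) \<Rightarrow> bool"
where
  "transitive_action G M \<phi> \<longleftrightarrow> (\<forall>\<xi>\<^sub>1\<in>M. \<forall>\<xi>\<^sub>2\<in>M. \<exists>Z\<in>carrier G. \<phi> Z \<xi>\<^sub>1 = \<xi>\<^sub>2)"

type_synonym vec3 = "real^3"
type_synonym mat3 = "real^3^3"

definition SO3 :: "mat3 set" where
  "SO3 = {A. rotation_matrix A}"

definition so3 :: "mat3 set" where
  "so3 = {a. transpose a = - a}"

definition wedge :: "vec3 \<Rightarrow> mat3" where
  "wedge v = matrix (cross3 v)"

text \<open>Only meaningful on \<^const>\<open>so3\<close>, the range of \<^const>\<open>wedge\<close>; see \<open>bij_betw_wedge\<close>.\<close>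

definition vee :: "mat3 \<Rightarrow> vec3" where
  "vee = inv_into UNIV wedge"

lemma wedge_nth:
  "wedge v $ 1 $ 1 = 0" "wedge v $ 1 $ 2 = - v$3" "wedge v $ 1 $ 3 = v$2"
  "wedge v $ 2 $ 1 = v$3" "wedge v $ 2 $ 2 = 0" "wedge v $ 2 $ 3 = - v$1"
  "wedge v $ 3 $ 1 = - v$2" "wedge v $ 3 $ 2 = v$1" "wedge v $ 3 $ 3 = 0"
  by (simp_all add: wedge_def matrix_def axis_def cross3_def)

lemma wedge_mult_vec: "wedge v *v w = cross3 v w"
  by (simp add: vec_eq_iff forall_3 matrix_vector_mult_def sum_3 wedge_nth cross3_def)

lemma bij_betw_wedge: "bij_betw wedge UNIV so3"
proof -
  have inj: "inj wedge"
  proof (rule injI)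
    fix v w assume "wedge v = wedge w"
    then have "wedge v $ i $ j = wedge w $ i $ j" for i j by simp
    from this[of 3 2] this[of 1 3] this[of 2 1] show "v = w"
      by (simp add: wedge_nth vec_eq_iff forall_3)
  qed
  have wedge_in: "wedge v \<in> so3" for v
    by (simp add: so3_def transpose_def vec_eq_iff forall_3 wedge_nth)
  have surj: "\<exists>v. a = wedge v" if "a \<in> so3" for a
  proof
    have skew: "a$j$i = - (a$i$j)" for i j
    proof -
      have "transpose a $ i $ j = (- a) $ i $ j"
        using that by (simp add: so3_def)
      then show ?thesis by (simp add: transpose_def)
    qed
    have "a$1$1 = 0" "a$2$2 = 0" "a$3$3 = 0"
      using skew[of 1 1] skew[of 2 2] skew[of 3 3] by linarith+
    then show "a = wedge (vector [a$3$2, a$1$3, a$2$1])"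
      using skew[of 1 2] skew[of 3 1] skew[of 2 3] by (simp add: vec_eq_iff forall_3 wedge_nth)
  qed
  show ?thesis
    unfolding bij_betw_def image_def using inj wedge_in surj by blast
qed

definition G_group :: "((mat3 \<times> mat3) \<times> mat3) monoid" where
  "G_group = \<lparr>carrier = (SO3 \<times> so3) \<times> SO3,
     mult = (\<lambda>((A\<^sub>X, a\<^sub>X), B\<^sub>X) ((A\<^sub>Y, a\<^sub>Y), B\<^sub>Y).
       ((A\<^sub>X ** A\<^sub>Y, a\<^sub>X + A\<^sub>X ** a\<^sub>Y ** transpose A\<^sub>X), B\<^sub>X ** B\<^sub>Y)),
     one = ((mat 1, 0), mat 1)\<rparr>"

definition M_manifold :: "((mat3 \<times> vec3) \<times> mat3) set" where
  "M_manifold = (SO3 \<times> UNIV) \<times> SO3"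

fun phi :: "(mat3 \<times> mat3) \<times> mat3 \<Rightarrow> (mat3 \<times> vec3) \<times> mat3
    \<Rightarrow> (mat3 \<times> vec3) \<times> mat3" where
  "phi ((A, a), B) ((R, b), C) =
     ((R ** A, transpose A *v (b - vee a)), transpose A ** C ** B)"

lemma SO3_iff: "A \<in> SO3 \<longleftrightarrow> transpose A ** A = mat 1 \<and> A ** transpose A = mat 1 \<and> det A = 1"
  by (auto simp: SO3_def rotation_matrix_def orthogonal_matrix_def)

lemma SO3_mult: "A \<in> SO3 \<Longrightarrow> B \<in> SO3 \<Longrightarrow> A ** B \<in> SO3"
  by (simp add: SO3_def rotation_matrix_def orthogonal_matrix_mul det_mul)

lemma SO3_transpose: "A \<in> SO3 \<Longrightarrow> transpose A \<in> SO3"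
  by (simp add: SO3_iff)

lemma SO3_one: "mat 1 \<in> SO3"
  by (simp add: SO3_iff)

lemma matrix_mul_add_left: "(A + B) ** C = A ** C + B ** (C::mat3)"
  by (simp add: vec_eq_iff matrix_matrix_mult_def sum.distrib algebra_simps)

lemma matrix_mul_uminus_left: "(- A) ** B = - (A ** (B::mat3))"
  by (simp add: vec_eq_iff matrix_matrix_mult_def sum_negf)

lemma matrix_mul_uminus_right: "A ** (- B) = - (A ** (B::mat3))"
  by (simp add: vec_eq_iff matrix_matrix_mult_def sum_negf)

lemma transpose_add: "transpose (A + B) = transpose A + transpose (B::mat3)"
  by (simp add: transpose_def vec_eq_iff)

lemma transpose_uminus: "transpose (- A) = - transpose (A::mat3)"
  by (simp add: transpose_def vec_eq_iff)

lemma so3_conj: "a \<in> so3 \<Longrightarrow> A ** a ** transpose A \<in> so3"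
  by (simp add: so3_def matrix_transpose_mul matrix_mul_assoc
      matrix_mul_uminus_left matrix_mul_uminus_right)

lemma so3_add: "a \<in> so3 \<Longrightarrow> b \<in> so3 \<Longrightarrow> a + b \<in> so3"
  by (simp add: so3_def transpose_add transpose_uminus)

lemma so3_uminus: "a \<in> so3 \<Longrightarrow> - a \<in> so3"
  by (simp add: so3_def transpose_add transpose_uminus)

lemma so3_zero: "0 \<in> so3"
  by (simp add: so3_def transpose_def vec_eq_iff)

lemma group_G: "group G_group"
proof (rule groupI)
  show "\<one>\<^bsub>G_group\<^esub> \<in> carrier G_group"
    by (simp add: G_group_def SO3_one so3_zero)
next
  fix X Y assume "X \<in> carrier G_group" "Y \<in> carrier G_group"
  then show "X \<otimes>\<^bsub>G_group\<^esub> Y \<in> carrier G_group"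
    by (auto simp: G_group_def intro!: SO3_mult so3_add so3_conj)
next
  fix X Y Z assume "X \<in> carrier G_group" "Y \<in> carrier G_group" "Z \<in> carrier G_group"
  then show "X \<otimes>\<^bsub>G_group\<^esub> Y \<otimes>\<^bsub>G_group\<^esub> Z = X \<otimes>\<^bsub>G_group\<^esub> (Y \<otimes>\<^bsub>G_group\<^esub> Z)"
    by (auto simp: G_group_def matrix_mul_assoc matrix_transpose_mul matrix_add_ldistrib
        matrix_mul_add_left)
next
  fix X assume "X \<in> carrier G_group"
  then show "\<one>\<^bsub>G_group\<^esub> \<otimes>\<^bsub>G_group\<^esub> X = X"
    by (auto simp: G_group_def)
next
  fix X assume "X \<in> carrier G_group"
  then obtain A a B where X: "X = ((A, a), B)" "A \<in> SO3" "a \<in> so3" "B \<in> SO3"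
    by (auto simp: G_group_def)
  show "\<exists>Y\<in>carrier G_group. Y \<otimes>\<^bsub>G_group\<^esub> X = \<one>\<^bsub>G_group\<^esub>"
  proof (rule bexI)
    show "((transpose A, - (transpose A ** a ** A)), transpose B) \<in> carrier G_group"
      using X so3_conj[of a "transpose A"] by (simp add: G_group_def SO3_transpose so3_uminus)
    show "((transpose A, - (transpose A ** a ** A)), transpose B) \<otimes>\<^bsub>G_group\<^esub> X = \<one>\<^bsub>G_group\<^esub>"
      using X by (simp add: G_group_def SO3_iff)
  qed
qed

lemma inv_G:
  assumes "A \<in> SO3" "a \<in> so3" "B \<in> SO3"
  shows "inv\<^bsub>G_group\<^esub> ((A, a), B) = ((transpose A, - (transpose A ** a ** A)), transpose B)"
proof -
  have "((transpose A, - (transpose A ** a ** A)), transpose B) \<otimes>\<^bsub>G_group\<^esub> ((A, a), B)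
      = \<one>\<^bsub>G_group\<^esub>"
    using assms by (simp add: G_group_def SO3_iff)
  moreover have "((A, a), B) \<in> carrier G_group"
    "((transpose A, - (transpose A ** a ** A)), transpose B) \<in> carrier G_group"
    using assms so3_conj[of a "transpose A"] by (auto simp: G_group_def SO3_transpose so3_uminus)
  ultimately show ?thesis
    using group.inv_equality[OF group_G] by blast
qed

end

theory Submission
  imports Defs
begin

text \<open>\<open>phi\<close> is the restriction of a polynomial map: on \<open>so3\<close> the
  inverse \<open>vee\<close> agrees with a linear map defined on all matrices, and everything else
  is built from projections, transposes and matrix products. Smoothness thus reduces to stability of
  the C^n classes under pairing and under linear and bilinear maps, the latter by the Leibniz rule
  (\<open>smooth_phi\<close>). The action law rests on \<open>vee_conj\<close>: rotations preserve
  the cross product, so conjugation by A on \<open>so3\<close> is the rotation A on vectors, and the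
  semidirect product of \<open>G_group\<close> acts on R^3 by rigid motions
  (\<open>phi_mult\<close>). For transitivity, the equation \<open>phi Z\<close> \<xi>1 = \<xi>2 can
  be solved explicitly for Z (\<open>transitive_phi\<close>).\<close>

subsection \<open>Closure properties of \<open>C\<^sup>n\<close> maps\<close>

text \<open>On an open set, equality on U is equality near each point, so it passes to derivatives
  and hence through the induction.\<close>

lemma higher_differentiable_on_cong:
  assumes "open U" "\<And>x. x \<in> U \<Longrightarrow> f x = g x" "higher_differentiable_on n U f"
  shows "higher_differentiable_on n U g"
  using assms(2,3)
proof (induction n arbitrary: f g)
  case 0
  then show ?case
    using continuous_on_cong[of U U f g] by simp
next
  case (Suc n)
  have der: "(g has_derivative frechet_derivative f (at x)) (at x)" if "x \<in> U" for x
    using that Suc.prems assms(1)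
    by (auto intro: has_derivative_transform_within_open simp: frechet_derivative_works)
  then have eq: "frechet_derivative f (at x) v = frechet_derivative g (at x) v" if "x \<in> U" for x v
    using that frechet_derivative_at by metis
  have "higher_differentiable_on n U (\<lambda>x. frechet_derivative g (at x) v)" for v
    by (rule Suc.IH[OF eq]) (use Suc.prems in auto)
  with der show ?case
    by (auto intro: differentiableI)
qed

text \<open>Uniqueness of the derivative allows any explicit f' in place of the choice made by
  \<open>frechet_derivative\<close>; the closure proofs below differentiate through this
  rule.\<close>

lemma higher_differentiable_on_SucI:
  assumes "open U" "\<And>x. x \<in> U \<Longrightarrow> (f has_derivative f' x) (at x)"
    and "\<And>v. higher_differentiable_on n U (\<lambda>x. f' x v)"
  shows "higher_differentiable_on (Suc n) U f"
proof -
  have "higher_differentiable_on n U (\<lambda>x. frechet_derivative f (at x) v)" for v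
    by (rule higher_differentiable_on_cong[OF assms(1) _ assms(3)[of v]])
      (metis assms(2) frechet_derivative_at)
  with assms(2) show ?thesis
    by (auto intro: differentiableI)
qed

text \<open>The Leibniz rule leaves one factor undifferentiated, so that factor must be lowered from
  C^(n+1) to C^n before the induction hypothesis applies.\<close>

lemma higher_differentiable_on_SucD:
  "higher_differentiable_on (Suc n) U f \<Longrightarrow> higher_differentiable_on n U f"
proof (induction n arbitrary: f)
  case 0
  then show ?case
    by (auto intro!: continuous_at_imp_continuous_on differentiable_imp_continuous_within)
next
  case (Suc n)
  show ?case
    using Suc.IH Suc.prems by (auto simp del: higher_differentiable_on.simps(1)
      simp: higher_differentiable_on.simps(2)[of "Suc n"])
qed

lemma higher_differentiable_on_const: "open U \<Longrightarrow> higher_differentiable_on n U (\<lambda>x. c)"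
proof (induction n arbitrary: c)
  case (Suc n)
  then show ?case
    by (intro higher_differentiable_on_SucI[where f' = "\<lambda>x v. 0"]) auto
qed simp

lemma higher_differentiable_on_add:
  assumes "open U" "higher_differentiable_on n U f" "higher_differentiable_on n U g"
  shows "higher_differentiable_on n U (\<lambda>x. f x + g x)"
  using assms(2,3)
proof (induction n arbitrary: f g)
  case 0
  then show ?case
    by (simp add: continuous_on_add)
next
  case (Suc n)
  show ?case
  proof (rule higher_differentiable_on_SucI[OF assms(1)])
    show "((\<lambda>x. f x + g x) has_derivative
        (\<lambda>v. frechet_derivative f (at x) v + frechet_derivative g (at x) v)) (at x)"
      if "x \<in> U" for x
      using that Suc.prems by (auto intro!: has_derivative_add simp: frechet_derivative_works)
  qed (use Suc in auto)
qed

lemma (in bounded_linear) higher_differentiable_on: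
  assumes "open U" "higher_differentiable_on n U g"
  shows "higher_differentiable_on n U (\<lambda>x. f (g x))"
  using assms(2)
proof (induction n arbitrary: g)
  case 0
  then show ?case
    by (simp add: continuous_on)
next
  case (Suc n)
  show ?case
  proof (rule higher_differentiable_on_SucI[OF assms(1)])
    show "((\<lambda>x. f (g x)) has_derivative (\<lambda>v. f (frechet_derivative g (at x) v))) (at x)"
      if "x \<in> U" for x
      using that Suc.prems by (auto intro!: has_derivative simp: frechet_derivative_works)
  qed (use Suc in auto)
qed

text \<open>Both terms of the Leibniz rule are again values of the same bilinear map, now at C^n
  arguments, so the induction has to run over arbitrary f and g.\<close>

lemma (in bounded_bilinear) higher_differentiable_on:
  assumes "open U" "higher_differentiable_on n U f" "higher_differentiable_on n U g"
  shows "higher_differentiable_on n U (\<lambda>x. prod (f x) (g x))"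
  using assms(2,3)
proof (induction n arbitrary: f g)
  case 0
  then show ?case
    by (simp add: continuous_on)
next
  case (Suc n)
  show ?case
  proof (rule higher_differentiable_on_SucI[OF assms(1)])
    show "((\<lambda>x. prod (f x) (g x)) has_derivative
        (\<lambda>v. prod (f x) (frechet_derivative g (at x) v) + prod (frechet_derivative f (at x) v) (g x))) (at x)"
      if "x \<in> U" for x
      using that Suc.prems by (auto intro!: FDERIV simp: frechet_derivative_works)
    show "higher_differentiable_on n U
        (\<lambda>x. prod (f x) (frechet_derivative g (at x) v) + prod (frechet_derivative f (at x) v) (g x))" for v
      using Suc.prems
      by (intro higher_differentiable_on_add[OF assms(1)] Suc.IH)
        (blast intro: higher_differentiable_on_SucD, simp_all add: higher_differentiable_on_SucD)
  qed
qed

lemma smooth_on_linear: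
  assumes "linear f" "open U"
  shows "smooth_on U f"
proof -
  have bl: "bounded_linear f"
    using assms(1) by (simp add: linear_conv_bounded_linear)
  have "higher_differentiable_on n U f" for n
  proof (cases n)
    case 0
    then show ?thesis
      using linear_continuous_on[OF bl] by simp
  next
    case (Suc m)
    then show ?thesis
      \<comment> \<open>A linear map is its own derivative at every point, so each directional
        derivative is constant.\<close>
      using bounded_linear_imp_has_derivative[OF bl] higher_differentiable_on_const[OF assms(2)]
      by (auto intro!: higher_differentiable_on_SucI[OF assms(2), where f' = "\<lambda>x. f"]
          simp del: higher_differentiable_on.simps)
  qed
  then show ?thesis
    by (simp add: smooth_on_def)
qed

lemma smooth_on_compose_linear:
  assumes "linear h" "open U" "smooth_on U f"
  shows "smooth_on U (\<lambda>x. h (f x))"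
  using assms bounded_linear.higher_differentiable_on[of h U _ f]
  by (simp add: smooth_on_def linear_conv_bounded_linear)

lemma smooth_on_compose_bilinear:
  assumes "bilinear h" "open U" "smooth_on U f" "smooth_on U g"
  shows "smooth_on U (\<lambda>x. h (f x) (g x))"
  using assms bounded_bilinear.higher_differentiable_on[of h U _ f g]
  by (simp add: smooth_on_def bilinear_conv_bounded_bilinear)

lemma smooth_on_Pair:
  assumes "open U" "smooth_on U f" "smooth_on U g"
  shows "smooth_on U (\<lambda>x. (f x, g x))"
proof -
  \<comment> \<open>The pair is the sum of the images of its components under the two linear
    embeddings into the product.\<close>
  have "smooth_on U (\<lambda>x. (f x, 0))" "smooth_on U (\<lambda>x. (0, g x))"
    using assms by (auto intro!: smooth_on_compose_linear[of "\<lambda>y. (y, 0)"]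
        smooth_on_compose_linear[of "\<lambda>y. (0, y)"] linearI)
  then have "smooth_on U (\<lambda>x. (f x, 0) + (0, g x))"
    using assms(1) higher_differentiable_on_add unfolding smooth_on_def by blast
  then show ?thesis
    by simp
qed

lemma bilinear_matrix_matrix_mult: "bilinear ((**) :: real^'n^'m \<Rightarrow> real^'p^'n \<Rightarrow> real^'p^'m)"
  unfolding bilinear_def
  by (auto intro!: linearI
      simp: vec_eq_iff matrix_matrix_mult_def sum.distrib algebra_simps sum_distrib_left)

lemma bilinear_matrix_vector_mult: "bilinear ((*v) :: real^'n^'m \<Rightarrow> real^'n \<Rightarrow> real^'m)"
  unfolding bilinear_def
  by (auto intro!: linearI
      simp: vec_eq_iff matrix_vector_mult_def sum.distrib algebra_simps sum_distrib_left)

subsection \<open>The map \<open>vee\<close>\<close>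

lemma vee_wedge [simp]: "vee (wedge v) = v"
  using bij_betw_wedge by (simp add: vee_def bij_betw_def)

lemma wedge_vee: "a \<in> so3 \<Longrightarrow> wedge (vee a) = a"
  using bij_betw_wedge by (simp add: vee_def bij_betw_def f_inv_into_f)

lemma wedge_in_so3: "wedge v \<in> so3"
  using bij_betw_wedge by (auto simp: bij_betw_def)

lemma linear_wedge: "linear wedge"
  by (rule linearI) (simp_all add: vec_eq_iff forall_3 wedge_nth)

lemma vee_zero [simp]: "vee 0 = 0"
  using vee_wedge[of 0] linear_0[OF linear_wedge] by simp

text \<open>Additivity is pulled back from \<open>wedge\<close> along its bijection onto
  \<open>so3\<close>, where \<open>wedge_vee\<close> recovers both summands.\<close>

lemma vee_add: "a \<in> so3 \<Longrightarrow> b \<in> so3 \<Longrightarrow> vee (a + b) = vee a + vee b"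
  using vee_wedge[of "vee a + vee b"] linear_add[OF linear_wedge, of "vee a" "vee b"]
  by (simp add: wedge_vee)

text \<open>Off \<open>so3\<close>, \<open>vee\<close> takes arbitrary values; this linear extension is what makes \<open>phi\<close>
  the restriction of a polynomial map.\<close>

definition vee_ext :: "mat3 \<Rightarrow> vec3" where
  "vee_ext a = vector [a$3$2, a$1$3, a$2$1]"

lemma linear_vee_ext: "linear vee_ext"
  by (rule linearI) (simp_all add: vec_eq_iff forall_3 vee_ext_def)

lemma vee_ext_eq_vee:
  assumes "a \<in> so3"
  shows "vee_ext a = vee a"
proof -
  have "vee_ext (wedge (vee a)) = vee a"
    by (simp add: vec_eq_iff forall_3 vee_ext_def wedge_nth)
  then show ?thesis
    by (simp add: assms wedge_vee)
qed

text \<open>Apply both matrices to a vector w: since A preserves cross products, A(v x A^T w) = Av x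
  A A^T w = Av x w. This identifies the adjoint action on \<open>so3\<close> with the standard
  action on R^3.\<close>

lemma vee_conj:
  assumes "A \<in> SO3" "a \<in> so3"
  shows "vee (A ** a ** transpose A) = A *v vee a"
proof -
  have "A ** wedge (vee a) ** transpose A = wedge (A *v vee a)"
  proof (rule matrix_eq[THEN iffD2], rule allI)
    fix w
    have "(A ** wedge (vee a) ** transpose A) *v w = A *v cross3 (vee a) (transpose A *v w)"
      by (simp only: wedge_mult_vec flip: matrix_vector_mul_assoc)
    also have "\<dots> = cross3 (A *v vee a) (A *v (transpose A *v w))"
      using assms(1) by (simp only: SO3_def mem_Collect_eq cross_rotation_matrix)
    also have "A *v (transpose A *v w) = w"
      using assms(1) by (simp only: SO3_iff matrix_vector_mul_assoc matrix_vector_mul_lid)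
    finally show "(A ** wedge (vee a) ** transpose A) *v w = wedge (A *v vee a) *v w"
      by (simp only: wedge_mult_vec)
  qed
  then show ?thesis
    using assms(2) by (metis vee_wedge wedge_vee)
qed

subsection \<open>The action\<close>

lemma phi_closed: "X \<in> carrier G_group \<Longrightarrow> \<xi> \<in> M_manifold \<Longrightarrow> phi X \<xi> \<in> M_manifold"
  by (auto simp: G_group_def M_manifold_def intro!: SO3_mult SO3_transpose)

lemma smooth_phi: "smooth_map (carrier G_group \<times> M_manifold) M_manifold (\<lambda>(X, \<xi>). phi X \<xi>)"
proof -
  \<comment> \<open>With \<open>vee_ext\<close> in place of \<open>vee\<close>, a single global
    formula serves as the local smooth extension at every point.\<close>
  define g :: "((mat3 \<times> mat3) \<times> mat3) \<times> ((mat3 \<times> vec3) \<times> mat3) \<Rightarrow> (mat3 \<times> vec3) \<times> mat3" where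
    "g = (\<lambda>p. ((fst (fst (snd p)) ** fst (fst (fst p)),
           transpose (fst (fst (fst p))) *v (snd (fst (snd p)) - vee_ext (snd (fst (fst p))))),
         transpose (fst (fst (fst p))) ** snd (snd p) ** snd (fst p)))"
  have lin_transpose: "linear (transpose :: mat3 \<Rightarrow> mat3)"
    by (rule linearI) (simp_all add: transpose_def vec_eq_iff)
  have "smooth_on UNIV g"
    unfolding g_def
    by (intro smooth_on_Pair smooth_on_compose_bilinear[OF bilinear_matrix_matrix_mult]
        smooth_on_compose_bilinear[OF bilinear_matrix_vector_mult] smooth_on_linear open_UNIV)
      \<comment> \<open>Once pairs and matrix products are split off, only linear functions of p
        remain: projections, a transposed block, and the difference involving
        \<open>vee_ext\<close>.\<close>
      (auto intro!: linearI simp: linear_add[OF linear_vee_ext] linear_cmul[OF linear_vee_ext]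
        linear_add[OF lin_transpose] linear_cmul[OF lin_transpose] algebra_simps)
  moreover have "g y = (\<lambda>(X, \<xi>). phi X \<xi>) y" if "y \<in> carrier G_group \<times> M_manifold" for y
    using that by (auto simp: g_def G_group_def M_manifold_def vee_ext_eq_vee)
  moreover have "(\<lambda>(X, \<xi>). phi X \<xi>) ` (carrier G_group \<times> M_manifold) \<subseteq> M_manifold"
    using phi_closed by auto
  ultimately show ?thesis
    unfolding smooth_map_def by (metis IntD2 UNIV_I open_UNIV)
qed

lemma phi_one: "\<xi> \<in> M_manifold \<Longrightarrow> phi \<one>\<^bsub>G_group\<^esub> \<xi> = \<xi>"
  by (auto simp: G_group_def M_manifold_def)

lemma phi_mult:
  assumes "X \<in> carrier G_group" "Y \<in> carrier G_group"
  shows "phi X (phi Y \<xi>) = phi (Y \<otimes>\<^bsub>G_group\<^esub> X) \<xi>"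
proof -
  obtain A a B where X: "X = ((A, a), B)" "A \<in> SO3" "a \<in> so3" "B \<in> SO3"
    using assms(1) by (auto simp: G_group_def)
  obtain A' a' B' where Y: "Y = ((A', a'), B')" "A' \<in> SO3" "a' \<in> so3" "B' \<in> SO3"
    using assms(2) by (auto simp: G_group_def)
  obtain R b C where \<xi>: "\<xi> = ((R, b), C)"
    by (metis prod.exhaust)
  have "vee (a' + A' ** a ** transpose A') = vee a' + A' *v vee a"
    using X Y by (simp add: vee_add vee_conj so3_conj)
  \<comment> \<open>A'^T undoes the rotation in front of \<open>vee a\<close>, leaving the vector
    part of \<open>phi Y\<close> \<xi> shifted by \<open>vee a\<close>, exactly what
    \<open>phi X\<close> then rotates by A^T.\<close>
  moreover have "transpose A' *v (b - (vee a' + A' *v vee a))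
      = transpose A' *v (b - vee a') - vee a"
    using Y by (simp add: SO3_iff matrix_vector_mult_diff_distrib matrix_vector_right_distrib
        matrix_vector_mul_assoc)
  ultimately show ?thesis
    using X Y \<xi> by (simp add: G_group_def matrix_transpose_mul matrix_mul_assoc
        flip: matrix_vector_mul_assoc)
qed

lemma transitive_phi: "transitive_action G_group M_manifold phi"
  unfolding transitive_action_def
proof (intro ballI)
  fix \<xi>\<^sub>1 \<xi>\<^sub>2 assume "\<xi>\<^sub>1 \<in> M_manifold" "\<xi>\<^sub>2 \<in> M_manifold"
  then obtain R b C R' b' C' where
    1: "\<xi>\<^sub>1 = ((R, b), C)" "R \<in> SO3" "C \<in> SO3" and 2: "\<xi>\<^sub>2 = ((R', b'), C')" "R' \<in> SO3" "C' \<in> SO3"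
    by (auto simp: M_manifold_def)
  \<comment> \<open>Z solves the three component equations in turn: R A = R' gives A, then A^T (b -
    \<open>vee a\<close>) = b' gives \<open>vee a\<close> = b - A b', and A^T C B = C' gives B = C^T
    A C'.\<close>
  define A where "A = transpose R ** R'"
  define Z where "Z = ((A, wedge (b - A *v b')), transpose C ** (A ** C'))"
  have A: "A \<in> SO3"
    using 1 2 by (simp add: A_def SO3_mult SO3_transpose)
  have cancel: "P ** (transpose P ** Q) = Q" "transpose P ** (P ** Q) = Q" if "P \<in> SO3" for P Q :: mat3
    using that by (simp_all add: SO3_iff matrix_mul_assoc)
  have "R ** A = R'"
    by (simp add: A_def cancel 1)
  moreover have "transpose A *v (A *v b') = b'"
    using A by (simp only: SO3_iff matrix_vector_mul_assoc matrix_vector_mul_lid)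
  moreover have "transpose A ** C ** (transpose C ** (A ** C')) = C'"
    by (simp only: cancel 1 A flip: matrix_mul_assoc)
  ultimately have "phi Z \<xi>\<^sub>1 = \<xi>\<^sub>2"
    by (simp add: Z_def 1 2)
  moreover have "Z \<in> carrier G_group"
    using A 1 2 by (simp add: Z_def G_group_def SO3_mult SO3_transpose wedge_in_so3)
  ultimately show "\<exists>Z\<in>carrier G_group. phi Z \<xi>\<^sub>1 = \<xi>\<^sub>2"
    by blast
qed

theorem lemma4p2p1:
  shows "right_group_action G_group M_manifold phi \<and> transitive_action G_group M_manifold phi"
  unfolding right_group_action_def
  using group_G smooth_phi phi_one phi_mult transitive_phi by blast

end
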